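(* Let $X=\{x_1,\dots,x_n\}$ be a finite set with $n\ge 1$ elements in a fixed enumeration, and let $(X,\bullet)$ be any groupoid on $X$. Then the $OJ$-factorization of $(X,\bullet)$ is unique: there is exactly one pair of groupoids $(X,\ast)$, $(X,\circ)$ such that $(X,\ast)$ is an orient-factor of $(X,\bullet)$, $(X,\circ)$ is a skew-factor of $(X,\bullet)$, and $(X,\bullet)=(X,\ast)\diamond(X,\circ)$.
   Context: A groupoid $(X,\bullet)$ is a non-empty set $X$ with an arbitrary binary operation $\bullet:X\times X\to X$. For groupoids $(X,\ast)$, $(X,\circ)$ on the same set $X$, the product $(X,\ast)\diamond(X,\circ)$ is the groupoid $(X,\cdot)$ with $x\cdot y=(x\ast y)\circ(y\ast x)$ for all $x,y\in X$. Let $X=\{x_1,\dots,x_n\}$ be finite with a fixed enumeration. A groupoid $(X,\ast)$ is an orient-factor of $(X,\bullet)$ if $x_i\ast x_j=x_j$ whenever $i+j=n+1$, and $x_i\ast x_j=x_i$ otherwise. A groupoid $(X,\circ)$ is a skew-factor of $(X,\bullet)$ if $x_i\circ x_j=x_j\bullet x_i$ whenever $i+j=n+1$, and $x_i\circ x_j=x_i\bullet x_j$ otherwise. *)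

theory Defs
  imports Main "HOL-Library.FuncSet"
begin

text \<open>
  A binary operation on the carrier \<open>X\<close> is a function from \<open>X \<times> X\<close> to \<open>X\<close> that is \<open>undefined\<close>
  outside \<open>X \<times> X\<close>. So equality of groupoids with carrier \<open>X\<close> is equality of their operations.
\<close>

definition groupoid :: "'a set \<Rightarrow> ('a \<times> 'a \<Rightarrow> 'a) \<Rightarrow> bool" where
  "groupoid X f \<longleftrightarrow> X \<noteq> {} \<and> f \<in> X \<times> X \<rightarrow>\<^sub>E X"

definition groupoid_prod ::
  "'a set \<Rightarrow> ('a \<times> 'a \<Rightarrow> 'a) \<Rightarrow> ('a \<times> 'a \<Rightarrow> 'a) \<Rightarrow> ('a \<times> 'a \<Rightarrow> 'a)" where
  "groupoid_prod X ast circ = (\<lambda>(a, b) \<in> X \<times> X. circ (ast (a, b), ast (b, a)))"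

text \<open>
  Below, \<open>x\<close> enumerates \<open>X\<close> as \<open>x 1, \<dots>, x n\<close>. The operation prescribed for an orient-factor
  does not depend on \<open>bul\<close>; the argument is kept because the notion is a relation between groupoids.
\<close>

definition orient_factor ::
  "'a set \<Rightarrow> nat \<Rightarrow> (nat \<Rightarrow> 'a) \<Rightarrow> ('a \<times> 'a \<Rightarrow> 'a) \<Rightarrow> ('a \<times> 'a \<Rightarrow> 'a) \<Rightarrow> bool" where
  "orient_factor X n x bul ast \<longleftrightarrow> groupoid X ast \<and>
     (\<forall>i\<in>{1..n}. \<forall>j\<in>{1..n}. ast (x i, x j) = (if i + j = n + 1 then x j else x i))"

definition skew_factor ::
  "'a set \<Rightarrow> nat \<Rightarrow> (nat \<Rightarrow> 'a) \<Rightarrow> ('a \<times> 'a \<Rightarrow> 'a) \<Rightarrow> ('a \<times> 'a \<Rightarrow> 'a) \<Rightarrow> bool" where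
  "skew_factor X n x bul circ \<longleftrightarrow> groupoid X circ \<and>
     (\<forall>i\<in>{1..n}. \<forall>j\<in>{1..n}.
        circ (x i, x j) = (if i + j = n + 1 then bul (x j, x i) else bul (x i, x j)))"

definition OJ_factorization ::
  "'a set \<Rightarrow> nat \<Rightarrow> (nat \<Rightarrow> 'a) \<Rightarrow> ('a \<times> 'a \<Rightarrow> 'a) \<Rightarrow>
     ('a \<times> 'a \<Rightarrow> 'a) \<times> ('a \<times> 'a \<Rightarrow> 'a) \<Rightarrow> bool" where
  "OJ_factorization X n x bul = (\<lambda>(ast, circ).
     orient_factor X n x bul ast \<and> skew_factor X n x bul circ \<and> bul = groupoid_prod X ast circ)"

end

theory Submission
  imports Defs
begin

text \<open>
  An operation on \<open>X\<close> is determined by its values on the pairs \<open>(x i, x j)\<close>, so each factor exists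
  and is unique. On the pairs with \<open>i + j = n + 1\<close>, which are closed under swapping,
  the orient-factor exchanges the arguments and the skew-factor exchanges them back.
\<close>

text \<open>Common form of both factor conditions, with \<open>g\<close> the prescribed table.
  Injectivity of \<open>x\<close> keeps the prescriptions from conflicting; surjectivity onto
  \<open>X\<close> leaves no value free.\<close>

lemma ex1_groupoid_of_values:
  assumes "bij_betw x I X" "I \<noteq> {}" "\<And>i j. i \<in> I \<Longrightarrow> j \<in> I \<Longrightarrow> g i j \<in> X"
  shows "\<exists>!f. groupoid X f \<and> (\<forall>i\<in>I. \<forall>j\<in>I. f (x i, x j) = g i j)"
proof (rule ex_ex1I)
  \<comment> \<open>\<open>y\<close> recovers the index of an element, so that the table
    \<open>g\<close> can be read as an operation on \<open>X\<close>.\<close>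
  define y where "y = inv_into I x"
  have y: "y (x i) = i" if "i \<in> I" for i
    using assms(1) that by (simp add: y_def bij_betw_inv_into_left)
  have X: "X = x ` I"
    using assms(1) by (simp add: bij_betw_def)
  let ?f = "\<lambda>(a, b) \<in> X \<times> X. g (y a) (y b)"
  have "groupoid X ?f"
    using assms(2,3) y by (auto simp: groupoid_def X)
  moreover have "\<forall>i\<in>I. \<forall>j\<in>I. ?f (x i, x j) = g i j"
    using y by (auto simp: X)
  ultimately show "\<exists>f. groupoid X f \<and> (\<forall>i\<in>I. \<forall>j\<in>I. f (x i, x j) = g i j)"
    by blast
next
  fix f f'
  assume f: "groupoid X f \<and> (\<forall>i\<in>I. \<forall>j\<in>I. f (x i, x j) = g i j)"
    and f': "groupoid X f' \<and> (\<forall>i\<in>I. \<forall>j\<in>I. f' (x i, x j) = g i j)"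
  have X: "X = x ` I"
    using assms(1) by (simp add: bij_betw_def)
  show "f = f'"
  \<comment> \<open>Both operations are \<open>undefined\<close> off \<open>X \<times> X\<close>, so
    agreement on \<open>X \<times> X\<close> suffices.\<close>
  proof (rule PiE_ext)
    show "f \<in> X \<times> X \<rightarrow>\<^sub>E X" "f' \<in> X \<times> X \<rightarrow>\<^sub>E X"
      using f f' by (auto simp: groupoid_def)
    show "f p = f' p" if "p \<in> X \<times> X" for p
      using that f f' by (auto simp: X)
  qed
qed

lemma groupoid_prod_orient_skew:
  assumes "x ` {1..n} = X" "groupoid X bul"
    and ast: "orient_factor X n x bul ast" and circ: "skew_factor X n x bul circ"
  shows "groupoid_prod X ast circ = bul"
proof
  fix p
  show "groupoid_prod X ast circ p = bul p"
  proof (cases "p \<in> X \<times> X")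
    case True
    then obtain i j where ij: "i \<in> {1..n}" "j \<in> {1..n}" "p = (x i, x j)"
      using assms(1) by auto
    have "groupoid_prod X ast circ p = circ (ast (x i, x j), ast (x j, x i))"
      using True ij by (simp add: groupoid_prod_def)
    \<comment> \<open>If \<open>i + j \<noteq> n + 1\<close>, then \<open>ast\<close> keeps the
      first argument in either order and \<open>circ\<close> is evaluated at
      \<open>(x i, x j)\<close>. By \<open>add.commute\<close>, \<open>(x i, x j)\<close> and
      \<open>(x j, x i)\<close> fall under the same case.\<close>
    also have "\<dots> = bul p"
      using ast circ ij by (simp add: orient_factor_def skew_factor_def add.commute)
    finally show ?thesis .
  next
    case False
    then show ?thesis
      using assms(2) PiE_arb[of bul "X \<times> X" "\<lambda>_. X" p] by (simp add: groupoid_prod_def groupoid_def)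
  qed
qed

theorem corollary4p1p3:
  fixes X :: "'a set" and n :: nat and x :: "nat \<Rightarrow> 'a" and bul :: "'a \<times> 'a \<Rightarrow> 'a"
  assumes "n \<ge> 1"
    and "bij_betw x {1..n} X"
    and "groupoid X bul"
  shows "\<exists>!p. OJ_factorization X n x bul p"
proof -
  have ne: "{1..n} \<noteq> {}"
    using assms(1) by simp
  have X: "x ` {1..n} = X"
    using assms(2) by (simp add: bij_betw_def)
  have mem: "x i \<in> X" if "i \<in> {1..n}" for i
    using X that by blast
  have bul: "bul (a, b) \<in> X" if "a \<in> X" "b \<in> X" for a b
    using assms(3) that by (auto simp: groupoid_def)
  have ast: "\<exists>!ast. orient_factor X n x bul ast"
    unfolding orient_factor_def
    by (rule ex1_groupoid_of_values[OF assms(2) ne]) (simp add: mem)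
  have circ: "\<exists>!circ. skew_factor X n x bul circ"
    unfolding skew_factor_def
    by (rule ex1_groupoid_of_values[OF assms(2) ne]) (simp add: mem bul)
  \<comment> \<open>The product equation follows from the two factor conditions, so existence and
    uniqueness of the pair split into those of its components.\<close>
  have OJ: "OJ_factorization X n x bul (ast, circ) \<longleftrightarrow>
      orient_factor X n x bul ast \<and> skew_factor X n x bul circ" for ast circ
    using groupoid_prod_orient_skew[OF X assms(3)] unfolding OJ_factorization_def prod.case by metis
  from ast circ obtain a c where "orient_factor X n x bul a" "skew_factor X n x bul c"
    by blast
  with ast circ show ?thesis
    by (intro ex1I[of _ "(a, c)"]) (auto simp: OJ)
qed

end
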